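(* Let $n,k$ be integers with $1\le k\le \frac n2-1$, and let $T\in\mathcal T_{n,k}$. Then $$\prod\nolimits_1(T)\ \le\ 9^{k}4^{\,n-2k-2}=\left(\tfrac{9}{16}\right)^{k}4^{\,n-2},$$ and equality holds if and only if the degree sequence of $T$ is $$(\underbrace{3,\ldots,3}_{k},\underbrace{2,\ldots,2}_{n-2k-2},\underbrace{1,\ldots,1}_{k+2}).$$
   Context: All graphs are finite, simple, connected and undirected; $d(v)$ denotes the degree of a vertex $v$. $\mathcal T_{n,k}$ is the class of trees with $n$ vertices in which exactly $k$ vertices have degree equal to the maximum vertex degree of the tree. The first multiplicative Zagreb index of a graph $G$ is $\prod_1(G)=\prod_{u\in V(G)}d(u)^2$. The degree sequence of a graph is the list of its vertex degrees in non-increasing order. *)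

theory Defs
  imports Complex_Main "HOL-Library.Multiset" "Graph_Theory.Graph_Theory"
begin

text \<open>
  Finite simple undirected graphs are the library's \<^locale>\<open>graph\<close>: finite, loop-free, symmetric
  digraphs without parallel arcs, so every undirected edge is a pair of opposite arcs. Hence the
  degree of a vertex is its out-degree, and the closed walk \<open>a, b, a\<close> along a single edge counts as
  a \<^const>\<open>pre_digraph.cycle\<close> of length 2. The library's \<^const>\<open>tree\<close> would therefore exclude every
  graph with an edge; the cycles of the undirected graph are those of length at least 3.
\<close>

definition undirected_cycle :: "('a, 'b) pre_digraph \<Rightarrow> 'b awalk \<Rightarrow> bool" where
  "undirected_cycle G p \<longleftrightarrow> pre_digraph.cycle G p \<and> length p \<ge> 3"

definition tree_graph :: "('a, 'b) pre_digraph \<Rightarrow> bool" where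
  "tree_graph G \<longleftrightarrow>
     graph G \<and> Digraph_Component.connected G \<and> \<not> (\<exists>p. undirected_cycle G p)"

definition vertex_degree :: "('a, 'b) pre_digraph \<Rightarrow> 'a \<Rightarrow> nat" where
  "vertex_degree G v = out_degree G v"

definition max_vertex_degree :: "('a, 'b) pre_digraph \<Rightarrow> nat" where
  "max_vertex_degree G = Max (vertex_degree G ` verts G)"

definition trees_with_max_degree_count :: "nat \<Rightarrow> nat \<Rightarrow> ('a, 'b) pre_digraph set" where
  "trees_with_max_degree_count n k =
     {T. tree_graph T \<and> card (verts T) = n \<and>
         card {v \<in> verts T. vertex_degree T v = max_vertex_degree T} = k}"

definition first_mult_zagreb :: "('a, 'b) pre_digraph \<Rightarrow> nat" where
  "first_mult_zagreb G = (\<Prod>u \<in> verts G. (vertex_degree G u)\<^sup>2)"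

definition degree_sequence :: "('a, 'b) pre_digraph \<Rightarrow> nat list" where
  "degree_sequence G =
     rev (sorted_list_of_multiset (image_mset (vertex_degree G) (mset_set (verts G))))"

end

theory Submission
  imports Defs
begin

text \<open>A tree has n - 1 edges, so its degrees sum to 2n - 2 and the numbers d(v) - 1 sum to n -
  2. Every d \<ge> 1 satisfies d \<le> 2^(d-1), with equality only for d = 1, 2, and every d \<ge> 3
  satisfies d \<le> (3/4) 2^(d-1), with equality only for d = 3. The degree sum forces the maximum
  degree to be at least 3, so the sharper inequality applies to the k vertices of maximum degree.
  Multiplying over all vertices bounds the product of the degrees by (3/4)^k 2^(n-2) = 3^k
  2^(n-2k-2), and the index is its square. Equality forces degree 3 at the k maximal vertices and
  degree 1 or 2 elsewhere; the number of vertices and the degree sum then fix how often each value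
  occurs. The degree sum is \<open>tree_graph_sum_degree\<close>, squeezed between
  \<open>card_acyclic_graph_le\<close> and \<open>card_connected_graph_ge\<close>; the optimisation
  is \<open>prod_le_of_sum_eq\<close>.\<close>

section \<open>Arc counts of acyclic and of connected symmetric relations\<close>

text \<open>Working with a plain relation and vertex lists makes passing to a subgraph a mere
  intersection. Length 3 excludes going back and forth along one edge.\<close>

definition acyclic_graph :: "('a \<times> 'a) set \<Rightarrow> bool" where
  "acyclic_graph E \<longleftrightarrow>
     \<not> (\<exists>xs. 3 \<le> length xs \<and> distinct xs \<and> successively (\<lambda>x y. (x, y) \<in> E) (xs @ [hd xs]))"

lemma acyclic_graph_mono:
  assumes "acyclic_graph E" and "F \<subseteq> E"
  shows "acyclic_graph F"
proof -
  have "successively (\<lambda>x y. (x, y) \<in> E) ys" if "successively (\<lambda>x y. (x, y) \<in> F) ys" for ys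
    using that assms(2) by (auto elim: successively_mono)
  then show ?thesis
    using assms(1) unfolding acyclic_graph_def by blast
qed

text \<open>The first vertex of a longest path has no neighbour outside the path, and a neighbour on the
  path other than the second vertex would close a cycle.\<close>

lemma acyclic_graph_leaf:
  assumes fin: "finite V" and ne: "V \<noteq> {}" and E: "E \<subseteq> V \<times> V" "sym E" "irrefl E"
    and acyc: "acyclic_graph E"
  obtains v where "v \<in> V" "card (E `` {v}) \<le> 1"
proof -
  define P where "P = {xs. xs \<noteq> [] \<and> distinct xs \<and> set xs \<subseteq> V \<and> successively (\<lambda>x y. (x, y) \<in> E) xs}"
  have "P \<subseteq> {xs. set xs \<subseteq> V \<and> distinct xs}"
    by (auto simp: P_def)
  then have finP: "finite P"
    by (rule finite_subset) (rule finite_subset_distinct[OF fin])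
  obtain r where "r \<in> V" using ne by blast
  then have "[r] \<in> P" by (simp add: P_def)
  then have neP: "P \<noteq> {}" by blast
  have "Max (length ` P) \<in> length ` P"
    using finP neP by (intro Max_in) auto
  then obtain xs where xs: "xs \<in> P" and "length xs = Max (length ` P)"
    by auto
  then have longest: "length ys \<le> length xs" if "ys \<in> P" for ys
    using finP that by simp
  from xs obtain v ys where xs_eq: "xs = v # ys"
    by (cases xs) (auto simp: P_def)
  \<comment> \<open>For a one-vertex path \<open>hd ys\<close> is an unspecified value; the claim
    then holds vacuously, since every neighbour of \<open>v\<close> lies in
    \<open>set ys\<close>.\<close>
  have "w = hd ys" if vw: "(v, w) \<in> E" for w
  proof (rule ccontr)
    assume nhd: "w \<noteq> hd ys"
    have wv: "(w, v) \<in> E" and "w \<noteq> v" and "w \<in> V"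
      using vw E by (auto dest: symD irreflD)
    have "w \<in> set xs"
    proof (rule ccontr)
      assume "w \<notin> set xs"
      then have "w # xs \<in> P"
        using xs xs_eq wv \<open>w \<in> V\<close> by (simp add: P_def)
      then show False using longest by fastforce
    qed
    then have "w \<in> set ys" using \<open>w \<noteq> v\<close> xs_eq by simp
    then obtain as bs where ys: "ys = as @ w # bs"
      by (meson split_list)
    have "as \<noteq> []" using nhd ys by auto
    have "successively (\<lambda>x y. (x, y) \<in> E) ((v # as @ [w]) @ bs)" "distinct (v # as @ [w])"
      using xs xs_eq ys by (auto simp: P_def)
    then have "successively (\<lambda>x y. (x, y) \<in> E) (v # as @ [w])"
      by (simp only: successively_append_iff)
    then have "successively (\<lambda>x y. (x, y) \<in> E) ((v # as @ [w]) @ [hd (v # as @ [w])])"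
      unfolding successively_append_iff[of _ "v # as @ [w]"] using wv by simp
    moreover have "3 \<le> length (v # as @ [w])"
      using \<open>as \<noteq> []\<close> by (cases as) auto
    ultimately show False
      using acyc \<open>distinct (v # as @ [w])\<close> unfolding acyclic_graph_def by blast
  qed
  then have "E `` {v} \<subseteq> {hd ys}" by auto
  then have "card (E `` {v}) \<le> 1"
    using card_mono[of "{hd ys}"] by simp
  moreover have "v \<in> V" using xs xs_eq by (simp add: P_def)
  ultimately show thesis using that by blast
qed

text \<open>Deleting a vertex with at most one neighbour removes at most two ordered pairs and keeps
  the rest acyclic, so induction applies until a single vertex is left.\<close>

lemma card_acyclic_graph_le:
  assumes "finite V" "V \<noteq> {}" "E \<subseteq> V \<times> V" "sym E" "irrefl E" "acyclic_graph E"
  shows "card E + 2 \<le> 2 * card V"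
  using assms
proof (induction V arbitrary: E rule: finite_psubset_induct)
  case (psubset V)
  obtain v where v: "v \<in> V" "card (E `` {v}) \<le> 1"
    using acyclic_graph_leaf[OF psubset.hyps psubset.prems] by blast
  define V' where "V' = V - {v}"
  define E' where "E' = E \<inter> V' \<times> V'"
  have fin: "finite V'" "finite E'" "finite (E `` {v})"
    using psubset.hyps finite_subset[OF \<open>E \<subseteq> V \<times> V\<close>]
    by (auto simp: V'_def E'_def)
  have cV: "card V = Suc (card V')"
    using v psubset.hyps unfolding V'_def by (metis card_Suc_Diff1)
  show ?case
  proof (cases "V' = {}")
    case True
    then have "V = {v}" using v by (auto simp: V'_def)
    then have "E = {}" using psubset.prems by (auto simp: irrefl_def)
    then show ?thesis using cV by simp
  next
    case False
    have "card E' + 2 \<le> 2 * card V'"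
    proof (rule psubset.IH)
      show "V' \<subset> V" using v by (auto simp: V'_def)
      show "sym E'" using \<open>sym E\<close> by (auto simp: E'_def sym_def)
      show "irrefl E'" using \<open>irrefl E\<close> by (auto simp: E'_def irrefl_def)
      show "acyclic_graph E'"
        using \<open>acyclic_graph E\<close> by (rule acyclic_graph_mono) (simp add: E'_def)
    qed (use False in \<open>auto simp: E'_def\<close>)
    moreover have "card E \<le> card E' + 2"
    proof -
      have "E \<subseteq> E' \<union> ({v} \<times> E `` {v} \<union> E `` {v} \<times> {v})"
        using \<open>E \<subseteq> V \<times> V\<close> \<open>sym E\<close> by (auto simp: E'_def V'_def dest: symD)
      then have "card E \<le> card (E' \<union> ({v} \<times> E `` {v} \<union> E `` {v} \<times> {v}))"
        using fin by (intro card_mono) auto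
      also have "\<dots> \<le> card E' + (card ({v} \<times> E `` {v}) + card (E `` {v} \<times> {v}))"
        by (meson card_Un_le add_left_mono order_trans)
      also have "\<dots> \<le> card E' + 2" using v by (simp add: card_cartesian_product)
      finally show ?thesis .
    qed
    ultimately show ?thesis using cV by simp
  qed
qed

text \<open>Grow a vertex set \<open>S\<close> from \<open>r\<close>: by connectedness each new vertex can be chosen adjacent to \<open>S\<close>,
  which adds two arcs.\<close>

lemma card_connected_graph_ge:
  assumes fin: "finite V" and E: "E \<subseteq> V \<times> V" "sym E"
    and r: "r \<in> V" and conn: "\<And>v. v \<in> V \<Longrightarrow> (r, v) \<in> E\<^sup>*"
  shows "2 * card V \<le> card E + 2"
proof -
  have finE: "finite E"
    using fin E(1) finite_subset by blast
  have "\<exists>S. S \<subseteq> V \<and> r \<in> S \<and> card S = Suc m \<and> 2 * m \<le> card (E \<inter> S \<times> S)" if "Suc m \<le> card V" for m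
    using that
  proof (induction m)
    case 0
    show ?case using r by (intro exI[of _ "{r}"]) auto
  next
    case (Suc m)
    then obtain S where S: "S \<subseteq> V" "r \<in> S" "card S = Suc m" "2 * m \<le> card (E \<inter> S \<times> S)"
      by auto
    have finS: "finite S" using S fin finite_subset by blast
    have "\<not> V \<subseteq> S" using S Suc.prems card_mono[OF finS, of V] by auto
    then obtain v where v: "v \<in> V" "v \<notin> S" by blast
    \<comment> \<open>If no arc left \<open>S\<close>, everything reachable from \<open>r\<close>
      would stay in \<open>S\<close>, yet \<open>v\<close> is reachable and outside.\<close>
    have "\<exists>x y. (x, y) \<in> E \<and> x \<in> S \<and> y \<notin> S"
    proof (rule ccontr)
      assume none: "\<not> ?thesis"
      have "w \<in> S" if "(r, w) \<in> E\<^sup>*" for w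
        using that by induction (use S none in auto)
      then show False using conn v by blast
    qed
    then obtain x y where xy: "(x, y) \<in> E" "x \<in> S" "y \<notin> S" by blast
    have "card (E \<inter> S \<times> S) + 2 = card ({(x, y), (y, x)} \<union> E \<inter> S \<times> S)"
    proof -
      have "x \<noteq> y" using xy by blast
      then have "card {(x, y), (y, x)} = 2" by simp
      then show ?thesis using xy finE by (subst card_Un_disjoint) auto
    qed
    also have "\<dots> \<le> card (E \<inter> insert y S \<times> insert y S)"
      using xy finE \<open>sym E\<close> by (intro card_mono) (auto dest: symD)
    finally have "2 * Suc m \<le> card (E \<inter> insert y S \<times> insert y S)"
      using S by simp
    moreover have "y \<in> V" using xy E by blast
    ultimately show ?case
      using S xy finS by (intro exI[of _ "insert y S"]) auto
  qed
  from this[of "card V - 1"] obtain S where "2 * (card V - 1) \<le> card (E \<inter> S \<times> S)"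
    using r fin by (metis Suc_diff_1 card_gt_0_iff empty_iff order_refl)
  also have "\<dots> \<le> card E" using finE by (simp add: card_mono)
  finally show ?thesis by simp
qed

section \<open>From digraphs to relations: walks, reachability and degree sum\<close>

text \<open>Library walks are lists of arcs, so an arc is chosen for each consecutive pair of the
  vertex list.\<close>

lemma (in wf_digraph) successively_imp_awalk:
  assumes "xs \<noteq> []" "set xs \<subseteq> verts G" "successively (\<lambda>x y. (x, y) \<in> arcs_ends G) xs"
  shows "\<exists>p. awalk (hd xs) p (last xs) \<and> awalk_verts (hd xs) p = xs"
  using assms
proof (induction xs)
  case Nil
  then show ?case by simp
next
  case (Cons x xs)
  show ?case
  proof (cases "xs = []")
    case True
    then show ?thesis
      using Cons.prems by (intro exI[of _ "[]"]) (simp add: awalk_Nil_iff)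
  next
    case False
    then have "(x, hd xs) \<in> arcs_ends G" "successively (\<lambda>x y. (x, y) \<in> arcs_ends G) xs"
      using Cons.prems by (auto simp: successively_Cons)
    then obtain e p where "e \<in> arcs G" "tail G e = x" "head G e = hd xs"
      and "awalk (hd xs) p (last xs)" "awalk_verts (hd xs) p = xs"
      using Cons False by auto
    then show ?thesis
      using False by (intro exI[of _ "e # p"]) (simp add: awalk_Cons_iff)
  qed
qed

lemma (in wf_digraph) acyclic_graph_arcs_ends:
  assumes "\<nexists>p. undirected_cycle G p"
  shows "acyclic_graph (arcs_ends G)"
  unfolding acyclic_graph_def
proof
  assume "\<exists>xs. 3 \<le> length xs \<and> distinct xs \<and>
    successively (\<lambda>x y. (x, y) \<in> arcs_ends G) (xs @ [hd xs])"
  then obtain xs where xs: "3 \<le> length xs" "distinct xs"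
    and succ: "successively (\<lambda>x y. (x, y) \<in> arcs_ends G) (xs @ [hd xs])"
    by blast
  have ne: "xs \<noteq> []" using xs by auto
  \<comment> \<open>Each vertex of the list has a successor, the last one because the list closes up
    with \<open>hd xs\<close>; ends of arcs are vertices.\<close>
  have "set xs \<subseteq> verts G"
  proof
    fix x assume "x \<in> set xs"
    then obtain as bs where split: "xs = as @ x # bs" by (meson split_list)
    then have "successively (\<lambda>x y. (x, y) \<in> arcs_ends G) ((x # bs) @ [hd xs])"
      using succ by (simp add: successively_append_iff)
    then have "(x, hd (bs @ [hd xs])) \<in> arcs_ends G"
      by (simp add: successively_Cons)
    then show "x \<in> verts G" by (rule adj_in_verts)
  qed
  moreover have "hd xs \<in> verts G" using ne calculation by auto
  ultimately obtain p where p: "awalk (hd xs) p (hd xs)" "awalk_verts (hd xs) p = xs @ [hd xs]"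
    using successively_imp_awalk[of "xs @ [hd xs]"] succ ne by auto
  have "length p = length xs"
    using length_awalk_verts[of "hd xs" p] p by simp
  moreover have "distinct (tl (awalk_verts (hd xs) p))"
    using p xs ne by (cases xs) auto
  ultimately have "undirected_cycle G p"
    unfolding undirected_cycle_def cycle_def using p xs by auto
  then show False using assms by blast
qed

lemma (in fin_digraph) sum_out_degree: "(\<Sum>v\<in>verts G. out_degree G v) = card (arcs G)"
proof -
  have "card (\<Union>v\<in>verts G. out_arcs G v) = (\<Sum>v\<in>verts G. card (out_arcs G v))"
    by (rule card_UN_disjoint) auto
  moreover have "(\<Union>v\<in>verts G. out_arcs G v) = arcs G" by auto
  ultimately show ?thesis by (simp add: out_degree_def)
qed

text \<open>Connectedness is defined through the symmetric closure, which has the same reachability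
  as the already symmetric \<open>T\<close>.\<close>

lemma tree_graph_reachable:
  assumes "tree_graph T" "u \<in> verts T" "v \<in> verts T"
  shows "(u, v) \<in> (arcs_ends T)\<^sup>*"
proof -
  interpret graph T using assms by (simp add: tree_graph_def)
  have "strongly_connected (mk_symmetric T)"
    using assms by (simp add: tree_graph_def connected_def)
  then have "u \<rightarrow>\<^sup>*\<^bsub>mk_symmetric T\<^esub> v"
    using assms by auto
  then have "u \<rightarrow>\<^sup>*\<^bsub>T\<^esub> v"
    using reachable_mk_symmetric_eq[OF sym_arcs] by simp
  then show ?thesis by (rule reachable_rtranclI)
qed

text \<open>Acyclicity bounds the number of arcs from above and connectedness from below by the same
  value. As there are no parallel arcs, arcs may be counted as pairs in
  \<open>arcs_ends T\<close>.\<close>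

lemma tree_graph_sum_degree:
  assumes "tree_graph T"
  shows "(\<Sum>v\<in>verts T. vertex_degree T v) + 2 = 2 * card (verts T)"
proof -
  interpret graph T using assms by (simp add: tree_graph_def)
  let ?E = "arcs_ends T"
  have "strongly_connected (mk_symmetric T)"
    using assms by (simp add: tree_graph_def connected_def)
  then have ne: "verts T \<noteq> {}" by (auto simp: strongly_connected_def)
  then obtain r where r: "r \<in> verts T" by blast
  have E: "?E \<subseteq> verts T \<times> verts T" "sym ?E" "irrefl ?E"
    using sym_arcs adj_not_same adj_in_verts by (auto simp: symmetric_def irrefl_def)
  have "card ?E + 2 \<le> 2 * card (verts T)"
    using assms by (intro card_acyclic_graph_le[OF finite_verts ne E] acyclic_graph_arcs_ends)
      (simp add: tree_graph_def)
  moreover have "2 * card (verts T) \<le> card ?E + 2"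
    using assms r tree_graph_reachable
    by (intro card_connected_graph_ge[OF finite_verts E(1,2)]) auto
  moreover have "card ?E = card (arcs T)"
    unfolding arcs_ends_def by (rule card_image[OF inj_on_arc_to_ends])
  ultimately show ?thesis
    by (simp add: vertex_degree_def sum_out_degree)
qed

text \<open>A walk from \<open>v\<close> to some other vertex has a first arc, and it leaves
  \<open>v\<close>.\<close>

lemma tree_graph_degree_pos:
  assumes "tree_graph T" "2 \<le> card (verts T)" "v \<in> verts T"
  shows "1 \<le> vertex_degree T v"
proof -
  interpret graph T using assms by (simp add: tree_graph_def)
  have "\<not> verts T \<subseteq> {v}"
    using assms(2) card_mono[of "{v}" "verts T"] by auto
  then obtain w where "w \<in> verts T" "w \<noteq> v" by blast
  then obtain x where "(v, x) \<in> arcs_ends T"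
    using tree_graph_reachable[OF assms(1,3)] by (metis converse_rtranclE)
  then obtain e where "e \<in> out_arcs T v" by auto
  then show ?thesis
    unfolding vertex_degree_def out_degree_def
    using card_gt_0_iff finite_out_arcs by (metis One_nat_def Suc_leI empty_iff)
qed

section \<open>Maximising a product of degrees with prescribed sum\<close>

lemma le_two_power_pred:
  fixes d :: nat
  assumes "1 \<le> d"
  shows "d \<le> 2 ^ (d - 1)" and "d = 2 ^ (d - 1) \<Longrightarrow> d = 1 \<or> d = 2"
proof -
  show "d \<le> 2 ^ (d - 1)"
    using less_exp[of "d - 1"] assms by linarith
  have less: "m + 3 < 2 ^ (m + 2)" for m :: nat
    by (induction m) auto
  show "d = 1 \<or> d = 2" if "d = 2 ^ (d - 1)"
  proof (rule ccontr)
    assume "\<not> ?thesis"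
    then have "3 \<le> d" using assms by linarith
    then obtain m where "d = m + 3" by (metis add.commute le_Suc_ex)
    then show False using less[of m] that by simp
  qed
qed

text \<open>The ratio of \<open>d\<close> to \<open>2 ^ (d - 1)\<close> decreases from
  \<open>d = 3\<close> on, where it equals 3/4; this explains the constants.\<close>

lemma four_mult_le_two_power_pred:
  fixes d :: nat
  assumes "3 \<le> d"
  shows "4 * d \<le> 3 * 2 ^ (d - 1)" and "4 * d = 3 * 2 ^ (d - 1) \<Longrightarrow> d = 3"
proof -
  have le: "4 * (m + 3) \<le> 3 * 2 ^ (m + 2)" for m :: nat
    by (induction m) auto
  have less: "4 * (m + 4) < 3 * 2 ^ (m + 3)" for m :: nat
    by (induction m) (auto simp: power_add)
  obtain m where m: "d = m + 3" using assms by (metis add.commute le_Suc_ex)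
  show "4 * d \<le> 3 * 2 ^ (d - 1)" using le[of m] m by simp
  show "d = 3" if "4 * d = 3 * 2 ^ (d - 1)"
  proof (rule ccontr)
    assume "d \<noteq> 3"
    then have "4 \<le> d" using assms by linarith
    then obtain m where "d = m + 4" by (metis add.commute le_Suc_ex)
    then show False using less[of m] that by simp
  qed
qed

text \<open>A single strict inequality would make the whole product strictly smaller, because all
  \<open>g i\<close> are positive.\<close>

lemma prod_eq_imp_eq:
  fixes f g :: "'a \<Rightarrow> nat"
  assumes "finite A" "\<And>i. i \<in> A \<Longrightarrow> f i \<le> g i" "\<And>i. i \<in> A \<Longrightarrow> 0 < g i"
    and "prod f A = prod g A" "i \<in> A"
  shows "f i = g i"
proof (rule ccontr)
  assume "f i \<noteq> g i"
  then have "prod f A < prod g A"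
    using assms by (intro prod_mono_strict[of i]) (auto simp: le_neq_implies_less)
  then show False using assms by simp
qed

lemma image_mset_mset_set_const:
  assumes "finite A" "\<And>x. x \<in> A \<Longrightarrow> f x = c"
  shows "image_mset f (mset_set A) = replicate_mset (card A) c"
  using assms by (induction A rule: finite_induct) auto

text \<open>Every vertex satisfies \<open>d v \<le> 2 ^ (d v - 1)\<close>, and a vertex of maximum degree even satisfies
  \<open>4 * d v \<le> 3 * 2 ^ (d v - 1)\<close>, because counting shows that the maximum is at least 3. Since the exponents
  add up to \<open>n - 2\<close>, multiplying these inequalities gives the bound.\<close>

lemma prod_le_of_sum_eq:
  fixes d :: "'a \<Rightarrow> nat"
  assumes fin: "finite V" and card_V: "card V = n"
    and K: "K = {v \<in> V. d v = M}" "card K = k"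
    and k: "1 \<le> k" "2 * k + 2 \<le> n"
    and pos: "\<forall>v\<in>V. 1 \<le> d v" and max: "\<forall>v\<in>V. d v \<le> M"
    and sum: "(\<Sum>v\<in>V. d v) + 2 = 2 * n"
  shows "prod d V \<le> 3 ^ k * 2 ^ (n - 2 * k - 2)"
    and "prod d V = 3 ^ k * 2 ^ (n - 2 * k - 2) \<Longrightarrow> image_mset d (mset_set V) =
      replicate_mset k 3 + replicate_mset (n - 2 * k - 2) 2 + replicate_mset (k + 2) 1"
proof -
  have KV: "K \<subseteq> V" "finite K" "V \<inter> K = K" using K fin by auto
  \<comment> \<open>Otherwise vertices in \<open>K\<close> have degree at most 2 and all others at
    most 1, so the sum is at most \<open>n + k\<close>; but it is \<open>2 * n - 2\<close>, which is
    at least \<open>n + 2 * k\<close>.\<close>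
  have "3 \<le> M"
  proof (rule ccontr)
    assume "\<not> 3 \<le> M"
    then have "d v \<le> 1 + (if v \<in> K then 1 else 0)" if "v \<in> V" for v
      using max that K by (cases "d v = M") auto
    then have "(\<Sum>v\<in>V. d v) \<le> (\<Sum>v\<in>V. 1 + (if v \<in> K then 1 else 0))"
      by (rule sum_mono)
    also have "\<dots> = n + k"
      using KV fin card_V K(2) unfolding sum.distrib by (simp add: sum.If_cases)
    finally show False using sum k by linarith
  qed
  \<comment> \<open>The factor 3/4 is split into weights 4 and 3 on the two sides, which keeps the
    comparison in the naturals.\<close>
  define f where "f v = (if v \<in> K then 4 else 1) * d v" for v
  define g :: "'a \<Rightarrow> nat" where "g v = (if v \<in> K then 3 else 1) * 2 ^ (d v - 1)" for v
  have fg: "f v \<le> g v" if "v \<in> V" for v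
    using le_two_power_pred(1)[of "d v"] pos that four_mult_le_two_power_pred(1)[of "d v"] \<open>3 \<le> M\<close> K
    by (auto simp: f_def g_def)
  have "(\<Sum>v\<in>V. d v - 1) = n - 2"
    using sum pos card_V by (simp add: sum_subtractf_nat)
  then have prod_g: "prod g V = 3 ^ k * 2 ^ (n - 2)"
    using KV fin K(2) unfolding g_def prod.distrib by (simp add: prod.If_cases flip: power_sum)
  have prod_f: "prod f V = 4 ^ k * prod d V"
    using KV fin K(2) unfolding f_def prod.distrib by (simp add: prod.If_cases)
  have "n - 2 = 2 * k + (n - 2 * k - 2)" using k by simp
  then have two_power: "(2::nat) ^ (n - 2) = 4 ^ k * 2 ^ (n - 2 * k - 2)"
    by (simp add: power_add power_mult)
  have "4 ^ k * prod d V \<le> 4 ^ k * (3 ^ k * 2 ^ (n - 2 * k - 2))"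
    using prod_mono[of V f g] fg prod_f prod_g two_power by (simp add: mult_ac)
  then show "prod d V \<le> 3 ^ k * 2 ^ (n - 2 * k - 2)" by simp
  assume "prod d V = 3 ^ k * 2 ^ (n - 2 * k - 2)"
  then have prod_eq: "prod f V = prod g V"
    using prod_f prod_g two_power by (simp add: mult_ac)
  have eq: "f v = g v" if "v \<in> V" for v
    by (rule prod_eq_imp_eq[of V])
      (use fin fg prod_eq that in \<open>auto simp: g_def\<close>)
  have d_K: "d v = 3" if "v \<in> K" for v
    using eq[of v] that KV four_mult_le_two_power_pred(2)[of "d v"] \<open>3 \<le> M\<close> K
    by (auto simp: f_def g_def)
  have d_notK: "d v = 1 \<or> d v = 2" if "v \<in> V - K" for v
    using eq[of v] that le_two_power_pred(2)[of "d v"] pos by (auto simp: f_def g_def)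
  define A where "A = {v \<in> V - K. d v = 2}"
  define B where "B = {v \<in> V - K. d v = 1}"
  have AB: "finite A" "finite B" "K \<inter> A = {}" "(K \<union> A) \<inter> B = {}" "V = K \<union> A \<union> B"
    using d_notK fin KV by (auto simp: A_def B_def)
  \<comment> \<open>With a and b the sizes of \<open>A\<close> and \<open>B\<close>, the equations n
    = k + a + b and 2n - 2 = 3k + 2a + b have the unique solution a = n - 2k - 2, b = k + 2.\<close>
  have "n = k + card A + card B"
    unfolding card_V[symmetric] AB(5) using AB KV K(2) by (simp add: card_Un_disjoint)
  moreover have "(\<Sum>v\<in>V. d v) = (\<Sum>v\<in>K. d v) + (\<Sum>v\<in>A. d v) + (\<Sum>v\<in>B. d v)"
    unfolding AB(5) using AB KV by (simp add: sum.union_disjoint)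
  then have "(\<Sum>v\<in>V. d v) = 3 * k + 2 * card A + card B"
    using d_K K(2) by (simp add: A_def B_def)
  ultimately have cards: "card A = n - 2 * k - 2" "card B = k + 2"
    using sum by simp_all
  have "image_mset d (mset_set V) =
      image_mset d (mset_set K) + image_mset d (mset_set A) + image_mset d (mset_set B)"
    unfolding AB(5) using AB KV by (simp add: mset_set_Union)
  also have "image_mset d (mset_set K) = replicate_mset k 3"
    unfolding K(2)[symmetric] by (rule image_mset_mset_set_const[OF KV(2) d_K])
  also have "image_mset d (mset_set A) = replicate_mset (n - 2 * k - 2) 2"
    unfolding cards[symmetric] by (rule image_mset_mset_set_const[OF AB(1)]) (simp add: A_def)
  also have "image_mset d (mset_set B) = replicate_mset (k + 2) 1"
    unfolding cards[symmetric] by (rule image_mset_mset_set_const[OF AB(2)]) (simp add: B_def)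
  finally show "image_mset d (mset_set V) =
      replicate_mset k 3 + replicate_mset (n - 2 * k - 2) 2 + replicate_mset (k + 2) 1" .
qed

section \<open>The index, the sorted degree sequence and the conclusion\<close>

lemma first_mult_zagreb_eq: "first_mult_zagreb G = (\<Prod>u\<in>verts G. vertex_degree G u)\<^sup>2"
  by (simp add: first_mult_zagreb_def prod_power_distrib)

lemma mset_degree_sequence:
  "mset (degree_sequence G) = image_mset (vertex_degree G) (mset_set (verts G))"
  by (simp add: degree_sequence_def)

lemma degree_sequence_eqI:
  assumes "image_mset (vertex_degree G) (mset_set (verts G)) = mset xs" and "sorted (rev xs)"
  shows "degree_sequence G = xs"
  using assms(2) sorted_sort_id[of "rev xs"]
  by (simp add: degree_sequence_def assms(1) flip: sorted_list_of_multiset_mset)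

theorem theorem3p2:
  fixes n k :: nat and T :: "('a, 'b) pre_digraph"
  assumes "1 \<le> k" and "real k \<le> real n / 2 - 1"
    and "T \<in> trees_with_max_degree_count n k"
  shows "real (first_mult_zagreb T) \<le> 9 ^ k * 4 ^ (n - 2 * k - 2)
    \<and> (9 :: real) ^ k * 4 ^ (n - 2 * k - 2) = (9 / 16) ^ k * 4 ^ (n - 2)
    \<and> (real (first_mult_zagreb T) = 9 ^ k * 4 ^ (n - 2 * k - 2) \<longleftrightarrow>
        degree_sequence T = replicate k 3 @ replicate (n - 2 * k - 2) 2 @ replicate (k + 2) 1)"
proof -
  let ?d = "vertex_degree T"
  let ?K = "{v \<in> verts T. ?d v = max_vertex_degree T}"
  let ?b = "3 ^ k * 2 ^ (n - 2 * k - 2) :: nat"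
  let ?L = "replicate k 3 @ replicate (n - 2 * k - 2) 2 @ replicate (k + 2) (1::nat)"
  have tree: "tree_graph T" and n: "card (verts T) = n" and k: "card ?K = k"
    using assms by (auto simp: trees_with_max_degree_count_def)
  interpret graph T using tree by (simp add: tree_graph_def)
  \<comment> \<open>Over the naturals the hypothesis also ensures that \<open>n - 2 * k - 2\<close>
    is not truncated.\<close>
  have kn: "2 * k + 2 \<le> n" using assms(2) by linarith
  have pos: "\<forall>v\<in>verts T. 1 \<le> ?d v"
    using tree_graph_degree_pos[OF tree] n kn by simp
  have max: "\<forall>v\<in>verts T. ?d v \<le> max_vertex_degree T"
    by (simp add: max_vertex_degree_def)
  have sum: "(\<Sum>v\<in>verts T. ?d v) + 2 = 2 * n"
    using tree_graph_sum_degree[OF tree] n by simp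
  note bound = prod_le_of_sum_eq[OF finite_verts n refl k \<open>1 \<le> k\<close> kn pos max sum]
  have rhs: "(9::real) ^ k * 4 ^ (n - 2 * k - 2) = real (?b\<^sup>2)"
  proof -
    have "(9::real) ^ k = (3 ^ k)\<^sup>2" "(4::real) ^ (n - 2 * k - 2) = (2 ^ (n - 2 * k - 2))\<^sup>2"
      by (simp_all add: power2_eq_square flip: power_mult_distrib)
    then show ?thesis by (simp add: power_mult_distrib)
  qed
  have "n - 2 = 2 * k + (n - 2 * k - 2)" using kn by simp
  then have "(4::real) ^ (n - 2) = 16 ^ k * 4 ^ (n - 2 * k - 2)"
    by (simp add: power_add power_mult)
  then have "(9 :: real) ^ k * 4 ^ (n - 2 * k - 2) = (9 / 16) ^ k * 4 ^ (n - 2)"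
    by (simp add: power_divide)
  moreover have "first_mult_zagreb T \<le> ?b\<^sup>2"
    unfolding first_mult_zagreb_eq by (rule power_mono[OF bound(1) zero_le])
  moreover have "first_mult_zagreb T = ?b\<^sup>2 \<longleftrightarrow> degree_sequence T = ?L"
  proof
    assume "first_mult_zagreb T = ?b\<^sup>2"
    then have "prod ?d (verts T) = ?b" unfolding first_mult_zagreb_eq by simp
    from bound(2)[OF this] show "degree_sequence T = ?L"
      by (intro degree_sequence_eqI) (auto simp: sorted_append)
  next
    \<comment> \<open>The product depends only on the multiset of degrees, so it can be computed
      from the list.\<close>
    assume "degree_sequence T = ?L"
    then have "image_mset ?d (mset_set (verts T)) = mset ?L"
      using mset_degree_sequence[of T] by simp
    then have "prod ?d (verts T) = prod_mset (mset ?L)"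
      by (simp only: prod_unfold_prod_mset)
    then show "first_mult_zagreb T = ?b\<^sup>2"
      unfolding first_mult_zagreb_eq by simp
  qed
  ultimately show ?thesis
    unfolding rhs of_nat_le_iff of_nat_eq_iff by blast
qed

end
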